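(* Let $k\ge 2$ and let $G=(V,E)$ be a finite simple graph. Then the facets of the total $(k+1)$-cut complex $\Delta^t_{k+1}(G)$ are precisely the ridges of $\Delta^t_k(G)$ that are contained in exactly $k+1$ facets of $\Delta^t_k(G)$.
   Context: For $j\ge 1$, the total $j$-cut complex $\Delta_j^t(G)$ is the simplicial complex on $V$ whose facets are the sets $V\setminus S$ where $S$ is an independent set of $G$ (no two vertices adjacent) of size $j$. When nonvoid it is pure of dimension $|V|-j-1$. A ridge of a pure simplicial complex is a face of dimension one less than the dimension of the complex. *)

theory Defs
  imports "HOL-Library.Ramsey"
begin

definition simple_graph :: "'a set \<Rightarrow> 'a set set \<Rightarrow> bool" where
  "simple_graph V E \<longleftrightarrow> finite V \<and> E \<subseteq> [V]\<^bsup>2\<^esup>"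

text \<open>
  An abstract simplicial complex is represented by the set of its faces. The empty face has
  dimension \<open>-1\<close>; the void complex \<open>{}\<close> has no faces at all, so its (unspecified)
  dimension is irrelevant for \<open>facets\<close> and \<open>ridges\<close>.
\<close>

definition facets :: "'a set set \<Rightarrow> 'a set set" where
  "facets K = {F \<in> K. \<forall>F' \<in> K. F \<subseteq> F' \<longrightarrow> F' = F}"

definition face_dim :: "'a set \<Rightarrow> int" where
  "face_dim F = int (card F) - 1"

definition complex_dim :: "'a set set \<Rightarrow> int" where
  "complex_dim K = Max (face_dim ` K)"

definition ridges :: "'a set set \<Rightarrow> 'a set set" where
  "ridges K = {R \<in> K. face_dim R = complex_dim K - 1}"

definition total_cut_complex :: "nat \<Rightarrow> 'a set \<Rightarrow> 'a set set \<Rightarrow> 'a set set" where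
  "total_cut_complex j V E = {F. \<exists>S \<in> [V]\<^bsup>j\<^esup>. indep S E \<and> F \<subseteq> V - S}"

text \<open>The generating sets \<open>V - S\<close> are exactly the inclusion-maximal faces, and the complex is
  pure of dimension \<open>|V| - j - 1\<close> when nonvoid.\<close>

lemma facets_total_cut_complex:
  assumes "finite V"
  shows "facets (total_cut_complex j V E) = {V - S | S. S \<in> [V]\<^bsup>j\<^esup> \<and> indep S E}"
    (is "?L = ?R")
proof
  show "?L \<subseteq> ?R"
  proof
    fix F assume "F \<in> ?L"
    then obtain S where S: "S \<in> [V]\<^bsup>j\<^esup>" "indep S E" "F \<subseteq> V - S"
      and max: "\<And>F'. F' \<in> total_cut_complex j V E \<Longrightarrow> F \<subseteq> F' \<Longrightarrow> F' = F"
      by (auto simp: facets_def total_cut_complex_def)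
    have "V - S \<in> total_cut_complex j V E" using S by (auto simp: total_cut_complex_def)
    from max[OF this S(3)] have "F = V - S" by (rule sym)
    thus "F \<in> ?R" using S(1,2) by auto
  qed
  show "?R \<subseteq> ?L"
  proof
    fix F assume "F \<in> ?R"
    then obtain S where S: "S \<in> [V]\<^bsup>j\<^esup>" "indep S E" "F = V - S" by blast
    have "F' = F" if "F' \<subseteq> V - T" "T \<in> [V]\<^bsup>j\<^esup>" "F \<subseteq> F'" for F' T
    proof -
      have "T \<subseteq> S" using that S by (auto simp: nsets_def)
      hence "T = S" using that(2) S(1) by (simp add: nsets_def card_subset_eq)
      thus ?thesis using that S by blast
    qed
    moreover have "F \<in> total_cut_complex j V E" using S by (auto simp: total_cut_complex_def)
    ultimately show "F \<in> ?L" by (auto simp: facets_def total_cut_complex_def)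
  qed
qed

lemma face_dim_facets_total_cut_complex:
  assumes "finite V" "F \<in> facets (total_cut_complex j V E)"
  shows "face_dim F = int (card V) - int j - 1"
proof -
  obtain S where S: "S \<subseteq> V" "finite S" "card S = j" "F = V - S"
    using assms by (auto simp: facets_total_cut_complex nsets_def)
  moreover have "card S \<le> card V" using S assms by (auto intro: card_mono)
  ultimately show ?thesis by (simp add: face_dim_def card_Diff_subset of_nat_diff)
qed

lemma complex_dim_total_cut_complex:
  assumes "finite V" "total_cut_complex j V E \<noteq> {}"
  shows "complex_dim (total_cut_complex j V E) = int (card V) - int j - 1"
proof -
  let ?K = "total_cut_complex j V E"
  have "?K \<subseteq> Pow V" by (auto simp: total_cut_complex_def)
  hence fin: "finite ?K" using assms(1) by (simp add: finite_subset)
  have facet_above: "\<exists>F' \<in> facets ?K. F \<subseteq> F'" if F: "F \<in> ?K" for F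
  proof -
    obtain S where "S \<in> [V]\<^bsup>j\<^esup>" "indep S E" "F \<subseteq> V - S"
      using F by (auto simp: total_cut_complex_def)
    thus ?thesis using facets_total_cut_complex[OF assms(1), of j E] by auto
  qed
  have sub: "facets ?K \<subseteq> ?K" by (auto simp: facets_def)
  show ?thesis unfolding complex_dim_def
  proof (rule Max_eqI)
    show "finite (face_dim ` ?K)" using fin by simp
    show "int (card V) - int j - 1 \<in> face_dim ` ?K"
    proof -
      obtain F where F: "F \<in> facets ?K" using facet_above assms(2) by blast
      show ?thesis using F sub face_dim_facets_total_cut_complex[OF assms(1) F]
        by (intro image_eqI[of _ _ F]) auto
    qed
  next
    fix d assume "d \<in> face_dim ` ?K"
    then obtain F where F: "F \<in> ?K" "d = face_dim F" by blast
    obtain F' where F': "F' \<in> facets ?K" "F \<subseteq> F'" using facet_above[OF F(1)] by blast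
    have "F' \<subseteq> V" using F' sub \<open>?K \<subseteq> Pow V\<close> by auto
    hence "finite F'" using assms(1) by (rule finite_subset)
    hence "card F \<le> card F'" using F'(2) by (rule card_mono)
    hence "face_dim F \<le> face_dim F'" by (simp add: face_dim_def)
    thus "d \<le> int (card V) - int j - 1"
      using F face_dim_facets_total_cut_complex[OF assms(1) F'(1)] by simp
  qed
qed

end

theory Submission
  imports Defs
begin

text \<open>
  Passing to complements in \<open>V\<close>, a ridge \<open>R\<close> of the \<open>k\<close>-th complex becomes a \<open>(k + 1)\<close>-set \<open>T\<close>,
  and the facets above \<open>R\<close> become the independent \<open>k\<close>-subsets of \<open>T\<close>. There are \<open>k + 1\<close> of these
  iff every \<open>k\<close>-subset of \<open>T\<close> is independent. As \<open>k \<ge> 2\<close>, any two vertices of \<open>T\<close> lie in a common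
  \<open>k\<close>-subset, so this says that \<open>T\<close> itself is independent.
\<close>

lemma indep_subset: "indep T E \<Longrightarrow> S \<subseteq> T \<Longrightarrow> indep S E"
  by (auto simp: indep_def)

text \<open>Complementation in \<open>V\<close> is injective on subsets of \<open>V\<close> and
  turns \<open>R \<subseteq> V - S\<close> into \<open>S \<subseteq> V - R\<close>.\<close>

lemma card_facets_above_total_cut_complex:
  assumes "finite V" "R \<subseteq> V"
  shows "card {F \<in> facets (total_cut_complex k V E). R \<subseteq> F} =
    card {S \<in> [V - R]\<^bsup>k\<^esup>. indep S E}"
proof -
  have "{F \<in> facets (total_cut_complex k V E). R \<subseteq> F} =
      (\<lambda>S. V - S) ` {S \<in> [V - R]\<^bsup>k\<^esup>. indep S E}"
    using assms by (auto simp: facets_total_cut_complex nsets_def)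
  moreover have "inj_on (\<lambda>S. V - S) {S \<in> [V - R]\<^bsup>k\<^esup>. indep S E}"
    by (rule inj_onI) (auto simp: nsets_def)
  ultimately show ?thesis by (simp add: card_image)
qed

text \<open>Independence is a condition on pairs of distinct vertices, and 2 \<le> k \<le> |T| lets
  each pair be enlarged to a k-subset of \<open>T\<close>.\<close>

lemma indep_if_indep_nsets:
  assumes "finite T" "2 \<le> k" "k \<le> card T"
    and indep: "\<And>S. S \<in> [T]\<^bsup>k\<^esup> \<Longrightarrow> indep S E"
  shows "indep T E"
  unfolding indep_def
proof (intro ballI impI)
  fix v w assume vw: "v \<in> T" "w \<in> T" "v \<noteq> w"
  have "\<exists>S. {v, w} \<subseteq> S \<and> S \<subseteq> T \<and> card S = k"
    using assms(1-3) vw by (intro exists_subset_between) auto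
  then obtain S where S: "{v, w} \<subseteq> S" "S \<subseteq> T" "card S = k" by blast
  then have "S \<in> [T]\<^bsup>k\<^esup>"
    using assms(1) by (auto simp: nsets_def intro: finite_subset)
  then show "{v, w} \<notin> E"
    using indep[of S] S vw by (auto simp: indep_def)
qed

text \<open>A (k+1)-set has exactly k+1 subsets of size k, so the count is attained only if the
  filter removes none of them.\<close>

lemma card_indep_nsets_eq_iff:
  assumes "2 \<le> k" "card T = k + 1"
  shows "card {S \<in> [T]\<^bsup>k\<^esup>. indep S E} = k + 1 \<longleftrightarrow> indep T E"
proof
  have fin: "finite T" using assms(2) by (intro card_ge_0_finite) simp
  have card: "card ([T]\<^bsup>k\<^esup>) = k + 1"
    using assms(2) by simp
  have finn: "finite ([T]\<^bsup>k\<^esup>)" using fin by (rule finite_imp_finite_nsets)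
  {
    assume "card {S \<in> [T]\<^bsup>k\<^esup>. indep S E} = k + 1"
    then have "{S \<in> [T]\<^bsup>k\<^esup>. indep S E} = [T]\<^bsup>k\<^esup>"
      using card finn by (intro card_subset_eq) auto
    then show "indep T E"
      using assms fin by (intro indep_if_indep_nsets[of T k]) auto
  next
    assume "indep T E"
    then have "{S \<in> [T]\<^bsup>k\<^esup>. indep S E} = [T]\<^bsup>k\<^esup>"
      by (auto simp: nsets_def intro: indep_subset)
    then show "card {S \<in> [T]\<^bsup>k\<^esup>. indep S E} = k + 1" using card by simp
  }
qed

text \<open>The existential clause says that \<open>R\<close> is a face. Its presence makes the
  complex nonvoid, so the dimension formula applies: a ridge has |V| - k - 1 vertices, which leaves
  k+1 in the complement.\<close>

lemma mem_ridges_total_cut_complex_iff: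
  assumes "finite V"
  shows "R \<in> ridges (total_cut_complex k V E) \<longleftrightarrow>
    R \<subseteq> V \<and> card (V - R) = k + 1 \<and> (\<exists>S \<in> [V - R]\<^bsup>k\<^esup>. indep S E)"
proof -
  have mem: "R \<in> total_cut_complex k V E \<longleftrightarrow> R \<subseteq> V \<and> (\<exists>S \<in> [V - R]\<^bsup>k\<^esup>. indep S E)"
    by (auto simp: total_cut_complex_def nsets_def)
  have "face_dim R = complex_dim (total_cut_complex k V E) - 1 \<longleftrightarrow> card (V - R) = k + 1"
    if R: "R \<in> total_cut_complex k V E"
  proof -
    have "R \<subseteq> V" using R mem by simp
    then have "card (V - R) + card R = card V"
      using assms by (metis card_Diff_subset card_mono finite_subset le_add_diff_inverse2)
    moreover have "complex_dim (total_cut_complex k V E) = int (card V) - int k - 1"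
      using complex_dim_total_cut_complex[OF assms] R by blast
    ultimately show ?thesis by (auto simp: face_dim_def)
  qed
  then show ?thesis using mem by (auto simp: ridges_def)
qed

theorem theorem3p1:
  fixes V :: "'a set" and E :: "'a set set" and k :: nat
  assumes "k \<ge> 2" and "simple_graph V E"
  shows "facets (total_cut_complex (k + 1) V E) =
    {R \<in> ridges (total_cut_complex k V E).
       card {F \<in> facets (total_cut_complex k V E). R \<subseteq> F} = k + 1}"
proof (rule set_eqI)
  fix R
  have fin: "finite V" using assms(2) by (simp add: simple_graph_def)
  have facet: "R \<in> facets (total_cut_complex (k + 1) V E) \<longleftrightarrow>
      R \<subseteq> V \<and> card (V - R) = k + 1 \<and> indep (V - R) E"
    using fin
    by (auto simp: facets_total_cut_complex nsets_def double_diff intro!: exI[of _ "V - R"])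
  \<comment> \<open>The count k+1 is positive, so an independent k-set avoiding \<open>R\<close>
    exists; this supplies the face condition for a ridge.\<close>
  have "\<exists>S \<in> [V - R]\<^bsup>k\<^esup>. indep S E" if "card {S \<in> [V - R]\<^bsup>k\<^esup>. indep S E} = k + 1"
    using that by (metis (no_types, lifting) Collect_empty_eq add_is_0 card.empty one_neq_zero)
  then show "R \<in> facets (total_cut_complex (k + 1) V E) \<longleftrightarrow>
      R \<in> {R \<in> ridges (total_cut_complex k V E).
        card {F \<in> facets (total_cut_complex k V E). R \<subseteq> F} = k + 1}"
    unfolding facet mem_Collect_eq mem_ridges_total_cut_complex_iff[OF fin]
    using card_facets_above_total_cut_complex[OF fin, of R k E]
      card_indep_nsets_eq_iff[OF assms(1), of "V - R" E]
    by auto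
qed

end
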